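(* For every prime $p>2$, \[ \sum_{n=0}^{p-1}\frac{10n+3}{2^{3n}}\binom{3n}{n}\binom{2n}{n}^2\equiv 0\pmod{p} \] and \[ \sum_{n=0}^{p-1}\frac{11n+3}{2^{6n}}\binom{3n}{n}\binom{2n}{n}^2\equiv 0\pmod{p}. \]
   Context: For rational numbers $x,y$ and a prime $p$, $x\equiv y\pmod{p^r}$ means that $x-y$ is a rational number whose $p$-adic valuation is at least $r$ (i.e. $(x-y)/p^r$ has numerator and denominator in lowest terms with denominator not divisible by $p$). *)

theory Defs
  imports Complex_Main "HOL-Computational_Algebra.Primes"
begin

(* quotient_of yields numerator and (positive) denominator in lowest terms, and
   quotient_of 0 = (0, 1), so equal rationals are congruent for every exponent r. *)
definition rat_cong :: "nat \<Rightarrow> nat \<Rightarrow> rat \<Rightarrow> rat \<Rightarrow> bool" where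
  "rat_cong p r x y \<longleftrightarrow> \<not> int p dvd snd (quotient_of ((x - y) / of_nat p ^ r))"

end

theory Submission imports Defs begin

text \<open>
  Each sum is the \<open>k = 0\<close> instance of a sum over \<open>n < p\<close> of \<open>g n k\<close>, where \<open>g\<close> belongs to a
  Wilf--Zeilberger pair \<open>(g, h)\<close>. Since \<open>g n k\<close> carries the factor \<open>1 / (n - k)!\<close>, it vanishes for
  \<open>k > n\<close>, so the sum for \<open>k = p\<close> is zero; hence the sum for \<open>k = 0\<close> equals minus the sum of the
  boundary terms \<open>h p k\<close> with \<open>k < p\<close>, and each of these is \<open>p\<close> times a \<open>p\<close>-integral rational.

  The first pair was found by computer search; the second one is the dual of the pair that comes
  from Dougall's bilateral form of Gauss's \<open>2F1\<close> summation when its parameters are shifted by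
  \<open>(1, 1, 3, 0)\<close>.
\<close>

section \<open>Telescoping a WZ pair\<close>

lemma wz_telescope:
  fixes g h :: "nat \<Rightarrow> nat \<Rightarrow> 'a::ab_group_add"
  assumes wz: "\<And>n k. g n (Suc k) - g n k = h (Suc n) k - h n k"
    and h0: "\<And>k. h 0 k = 0"
    and g0: "\<And>n k. n < k \<Longrightarrow> g n k = 0"
  shows "(\<Sum>n<N. g n 0) = - (\<Sum>k<N. h N k)"
proof -
  \<comment> \<open>Summing \<open>wz\<close> over \<open>n < N\<close> collapses the right-hand
    side to \<open>h N k\<close>, since \<open>h0\<close> kills the lower end; induction on
    \<open>K\<close> adds these up.\<close>
  have *: "(\<Sum>n<N. g n K) - (\<Sum>n<N. g n 0) = (\<Sum>k<K. h N k)" for K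
  proof (induction K)
    case (Suc K)
    have "(\<Sum>n<N. g n (Suc K)) - (\<Sum>n<N. g n K) = (\<Sum>n<N. h (Suc n) K - h n K)"
      by (simp add: wz flip: sum_subtractf)
    also have "\<dots> = h N K"
      using sum_lessThan_telescope[of "\<lambda>n. h n K" N] by (simp add: h0)
    finally show ?case
      using Suc by (simp add: algebra_simps)
  qed simp
  have "(\<Sum>n<N. g n N) = 0"
    by (simp add: g0)
  with *[of N] show ?thesis
    by (metis diff_0 minus_minus)
qed

section \<open>Rationals integral at \<open>p\<close>\<close>

text \<open>Membership in the localization of the integers at \<open>p\<close>. The fraction need
  not be reduced, so sums and products simply multiply denominators.\<close>

definition p_integral :: "nat \<Rightarrow> rat \<Rightarrow> bool" where
  "p_integral p x \<longleftrightarrow> (\<exists>a b. x = of_int a / of_int b \<and> \<not> int p dvd b)"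

lemma p_integral_of_int: "prime p \<Longrightarrow> p_integral p (of_int a)"
  unfolding p_integral_def
  by (rule exI[of _ a], rule exI[of _ 1]) (auto dest: prime_gt_1_nat)

lemma p_integral_of_nat: "prime p \<Longrightarrow> p_integral p (of_nat a)"
  using p_integral_of_int[of p "int a"] by simp

lemma p_integral_inverse_of_nat: "\<not> p dvd b \<Longrightarrow> p_integral p (1 / of_nat b)"
  unfolding p_integral_def
  by (rule exI[of _ 1], rule exI[of _ "int b"]) simp

lemma p_integral_mult:
  assumes "prime p" "p_integral p x" "p_integral p y"
  shows "p_integral p (x * y)"
proof -
  obtain a b c d where "x = of_int a / of_int b" "\<not> int p dvd b"
    "y = of_int c / of_int d" "\<not> int p dvd d"
    using assms unfolding p_integral_def by blast
  moreover have "\<not> int p dvd b * d"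
    using calculation \<open>prime p\<close> by (simp add: prime_dvd_mult_iff)
  ultimately show ?thesis
    unfolding p_integral_def by (intro exI[of _ "a * c"] exI[of _ "b * d"]) simp
qed

lemma p_integral_add:
  assumes "prime p" "p_integral p x" "p_integral p y"
  shows "p_integral p (x + y)"
proof -
  obtain a b c d where *: "x = of_int a / of_int b" "\<not> int p dvd b"
    "y = of_int c / of_int d" "\<not> int p dvd d"
    using assms unfolding p_integral_def by blast
  then have "b \<noteq> 0" "d \<noteq> 0"
    by auto
  moreover have "\<not> int p dvd b * d"
    using * \<open>prime p\<close> by (simp add: prime_dvd_mult_iff)
  ultimately show ?thesis
    using * unfolding p_integral_def
    by (intro exI[of _ "a * d + c * b"] exI[of _ "b * d"]) (simp add: add_frac_eq)
qed

lemma p_integral_power: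
  "prime p \<Longrightarrow> p_integral p x \<Longrightarrow> p_integral p (x ^ n)"
  using p_integral_of_int[of p 1] by (induction n) (auto intro: p_integral_mult)

lemma p_integral_prod:
  "prime p \<Longrightarrow> (\<And>i. i \<in> A \<Longrightarrow> p_integral p (f i)) \<Longrightarrow> p_integral p (prod f A)"
  using p_integral_of_int[of p 1]
  by (induction A rule: infinite_finite_induct) (auto intro: p_integral_mult)

lemma p_integral_sum:
  "prime p \<Longrightarrow> (\<And>i. i \<in> A \<Longrightarrow> p_integral p (f i)) \<Longrightarrow> p_integral p (sum f A)"
  using p_integral_of_int[of p 0]
  by (induction A rule: infinite_finite_induct) (auto intro: p_integral_add)

lemma p_integral_pochhammer:
  assumes "prime p" "p_integral p x"
  shows "p_integral p (pochhammer x n)"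
  unfolding pochhammer_prod
  using assms by (intro p_integral_prod p_integral_add p_integral_of_nat)

lemma p_integral_half: "prime p \<Longrightarrow> p > 2 \<Longrightarrow> p_integral p (1 / 2)"
  using p_integral_inverse_of_nat[of p 2] nat_dvd_not_less[of 2 p] by simp

lemma p_integral_inverse_fact: "prime p \<Longrightarrow> n < p \<Longrightarrow> p_integral p (1 / fact n)"
  using p_integral_inverse_of_nat[of p "fact n"] by (simp add: prime_dvd_fact_iff)

text \<open>Passage to lowest terms: if \<open>y = a / b = c / d\<close> with \<open>c / d\<close>
  reduced, then \<open>a * d = c * b\<close>. Were \<open>p\<close> to divide \<open>d\<close>, it
  would divide \<open>c * b\<close>, hence \<open>c\<close>, against coprimality.\<close>

lemma rat_cong_0I:
  assumes "prime p" "x = of_nat p * y" "p_integral p y"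
  shows "rat_cong p 1 x 0"
proof -
  obtain a b where ab: "y = of_int a / of_int b" "\<not> int p dvd b"
    using assms(3) unfolding p_integral_def by blast
  obtain c d where cd: "quotient_of y = (c, d)"
    by force
  have "b \<noteq> 0" "d > 0" "coprime c d" "y = of_int c / of_int d"
    using ab(2) cd quotient_of_denom_pos[OF cd] quotient_of_coprime[OF cd] quotient_of_div[OF cd]
    by auto
  then have "(of_int (a * d) :: rat) = of_int (c * b)"
    using ab by (simp add: field_simps)
  then have eq: "a * d = c * b"
    by (simp only: of_int_eq_iff)
  have pp: "prime (int p)"
    using assms by simp
  have "\<not> int p dvd d"
  proof
    assume "int p dvd d"
    then have "int p dvd c * b"
      by (metis eq dvd_mult)
    then have "int p dvd c"
      using ab(2) pp by (simp add: prime_dvd_mult_iff)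
    with \<open>int p dvd d\<close> \<open>coprime c d\<close> pp show False
      using coprime_common_divisor not_prime_unit by blast
  qed
  moreover have "(x - 0) / of_nat p ^ 1 = y"
    using assms by (simp add: prime_gt_0_nat)
  ultimately show ?thesis
    unfolding rat_cong_def by (simp only: cd snd_conv) simp
qed

text \<open>Extending \<open>1 / (n - k)!\<close> by zero makes its two recurrences hold for all \<open>n\<close> and \<open>k\<close>.\<close>

definition rfact :: "nat \<Rightarrow> nat \<Rightarrow> rat" where
  "rfact n k = (if k \<le> n then 1 / fact (n - k) else 0)"

lemma rfact_Suc_right: "rfact n (Suc k) = (of_nat n - of_nat k) * rfact n k"
proof (cases "Suc k \<le> n")
  case True
  then have "fact (n - k) = (of_nat (n - k) * fact (n - Suc k) :: rat)"
    by (metis Suc_diff_le diff_Suc_Suc fact_Suc)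
  with True show ?thesis
    by (simp add: rfact_def of_nat_diff)
qed (auto simp: rfact_def)

lemma rfact_Suc_left: "(of_nat n + 1 - of_nat k) * rfact (Suc n) k = rfact n k"
proof -
  have "rfact (Suc n) (Suc k) = rfact n k"
    by (simp add: rfact_def)
  then show ?thesis
    using rfact_Suc_right[of "Suc n" k] by (simp add: add.commute)
qed

section \<open>The first WZ pair\<close>

definition g10 :: "nat \<Rightarrow> nat \<Rightarrow> rat" where
  "g10 n k = (10 * of_nat n + 3 + 2 * of_nat k) * fact (3 * n) * pochhammer (1 / 2) (n + k)
     * (-4) ^ k * rfact n k / (2 ^ n * fact n ^ 2 * fact (n + 2 * k))"

text \<open>This is \<open>g10 n k\<close> times the rational certificate
  \<open>-4 * n * (n - k) / ((10 * n + 2 * k + 3) * (n + 2 * k + 1))\<close>. The product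
  \<open>(n - k) * rfact n k\<close> stays grouped because its shift in \<open>n\<close> is
  \<open>rfact n k\<close>.\<close>

definition h10 :: "nat \<Rightarrow> nat \<Rightarrow> rat" where
  "h10 n k = -4 * of_nat n * ((of_nat n - of_nat k) * rfact n k) * fact (3 * n)
     * pochhammer (1 / 2) (n + k) * (-4) ^ k / (2 ^ n * fact n ^ 2 * fact (n + 2 * k + 1))"

lemma wz10: "g10 n (Suc k) - g10 n k = h10 (Suc n) k - h10 n k"
proof -
  define x y :: rat where "x = of_nat n" and "y = of_nat k"
  have pos: "x \<ge> 0" "y \<ge> 0"
    by (simp_all add: x_def y_def)
  \<comment> \<open>All four terms are polynomial multiples of this hypergeometric term, leaving a
    polynomial identity in \<open>x\<close> and \<open>y\<close>. Its denominator has the largest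
    factorial that occurs, the one in \<open>g10 n (Suc k)\<close> and
    \<open>h10 (Suc n) k\<close>.\<close>
  define A where "A = fact (3 * n) * pochhammer (1 / 2) (n + k) * (-4) ^ k * rfact n k
     / (2 ^ n * fact n ^ 2 * fact (n + 2 * k + 2))"
  have nz: "x + 2 * y + 1 \<noteq> 0" "x + 2 * y + 2 \<noteq> 0" "x + 1 \<noteq> 0"
    using pos by linarith+
  have f1: "fact (n + 2 * k + 1) = (x + 2 * y + 1) * fact (n + 2 * k)"
    by (simp add: x_def y_def algebra_simps)
  have f2: "fact (n + 2 * k + 2) = (x + 2 * y + 2) * ((x + 2 * y + 1) * fact (n + 2 * k))"
    by (simp add: x_def y_def algebra_simps)
  have 1: "g10 n k = A * ((10 * x + 3 + 2 * y) * (x + 2 * y + 1) * (x + 2 * y + 2))"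
    using nz unfolding g10_def A_def f2 by (simp flip: x_def y_def) (simp add: mult_ac)
  have 2: "h10 n k = A * (-4 * x * (x - y) * (x + 2 * y + 2))"
    using nz unfolding h10_def A_def f1 f2 by (simp flip: x_def y_def) (simp add: mult_ac)
  have Suc_k: "fact (n + 2 * Suc k) = (fact (n + 2 * k + 2) :: rat)"
    "pochhammer (1 / 2) (n + Suc k) = (x + y + 1 / 2) * pochhammer (1 / 2) (n + k)"
    "10 * of_nat n + 3 + 2 * of_nat (Suc k) = 10 * x + 5 + 2 * y"
    by (simp_all add: pochhammer_Suc x_def y_def)
  have 3: "g10 n (Suc k) = A * (-4 * (10 * x + 5 + 2 * y) * (x + y + 1 / 2) * (x - y))"
    unfolding g10_def A_def Suc_k rfact_Suc_right
    by (simp add: mult_ac del: distrib_left_numeral flip: x_def y_def)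
  have f3: "fact (3 * Suc n) = (3 * x + 3) * (3 * x + 2) * (3 * x + 1) * fact (3 * n)"
    by (simp add: x_def numeral_3_eq_3 algebra_simps)
  have f4: "fact (Suc n + 2 * k + 1) = (fact (n + 2 * k + 2) :: rat)"
    by simp
  have f5: "fact (Suc n) = (x + 1) * fact n"
    by (simp add: x_def algebra_simps)
  have f6: "(of_nat (Suc n) - of_nat k) * rfact (Suc n) k = rfact n k"
    using rfact_Suc_left[of n k] by (simp add: algebra_simps)
  \<comment> \<open>The last factor is 1 left uncancelled: \<open>(x + 1) ^ 2\<close> arises above
    from \<open>Suc n\<close> and \<open>3 * x + 3\<close>, below from
    \<open>fact (Suc n) ^ 2\<close>.\<close>
  have "h10 (Suc n) k = A * (-6 * (3 * x + 2) * (3 * x + 1) * (x + y + 1 / 2) * ((x + 1) / (x + 1)) ^ 2)"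
    unfolding h10_def f3 f4 f5 f6 A_def
    by (simp add: pochhammer_Suc power2_eq_square x_def y_def divide_simps del: fact_Suc) (simp add: algebra_simps)
  then have 4: "h10 (Suc n) k = A * (-6 * (3 * x + 2) * (3 * x + 1) * (x + y + 1 / 2))"
    using nz by simp
  show ?thesis
    unfolding 1 2 3 4 by (simp add: algebra_simps)
qed

lemma half_pochhammer: "pochhammer (1 / 2 :: rat) n = fact (2 * n) / (4 ^ n * fact n)"
  by (simp add: fact_double power_mult)

lemma fact_3_choose: "of_nat (3 * n choose n) = (fact (3 * n) / (fact n * fact (2 * n)) :: rat)"
  by (subst binomial_fact) (simp_all add: mult.commute)

lemma fact_2_choose: "of_nat (2 * n choose n) = (fact (2 * n) / (fact n * fact n) :: rat)"
  by (subst binomial_fact) (simp_all add: mult.commute)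

lemma g10_0:
  "g10 n 0 = (10 * of_nat n + 3) / 2 ^ (3 * n) * of_nat ((3 * n) choose n) * of_nat ((2 * n) choose n) ^ 2"
proof -
  have "(2 :: rat) ^ (3 * n) = 2 ^ n * 4 ^ n"
    by (simp add: power_mult flip: power_mult_distrib)
  then show ?thesis
    unfolding g10_def half_pochhammer fact_3_choose fact_2_choose rfact_def
    by (simp add: power2_eq_square) (simp add: mult_ac)
qed

text \<open>Grouping the factorials into binomial coefficients shows the cofactor of
  \<open>N\<close> to be an integer over a power of 2, hence integral at odd primes, with no count
  of the powers of \<open>p\<close> in each factorial.\<close>

lemma h10_eq:
  assumes "k < N"
  shows "h10 N k = of_nat N * (-12 * (-4) ^ k * (1 / 2) ^ N * (1 / 2) ^ (2 * (N + k))
    * of_nat ((3 * N - 1) choose N) * of_nat ((2 * N - 1) choose (N + k))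
    * of_nat ((2 * (N + k)) choose (N - 1)))"
proof -
  define j where "j = N - Suc k"
  have N: "N = Suc (k + j)"
    using assms by (simp add: j_def)
  have c1: "of_nat ((3 * N - 1) choose N) = (fact (3 * N - 1) / (fact N * fact (2 * N - 1)) :: rat)"
    using N by (subst binomial_fact) (auto simp: algebra_simps)
  have c2: "of_nat ((2 * N - 1) choose (N + k)) = (fact (2 * N - 1) / (fact (N + k) * fact j) :: rat)"
    using N by (subst binomial_fact) (auto simp: algebra_simps)
  have c3: "of_nat ((2 * (N + k)) choose (N - 1))
      = (fact (2 * (N + k)) / (fact (N - 1) * fact (N + 2 * k + 1)) :: rat)"
    using N by (subst binomial_fact) (auto simp: algebra_simps)
  have r: "(of_nat N - of_nat k) * rfact N k = 1 / fact j"
    using rfact_Suc_right[of N k] assms by (simp add: rfact_def j_def)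
  \<comment> \<open>Of the two factors \<open>N\<close> in \<open>-4 * N * fact (3 * N)\<close>, one
    cancels against \<open>fact N = N * fact (N - 1)\<close> and the other is pulled out;
    \<open>-4 * 3\<close> gives the constant -12.\<close>
  have f3: "fact (3 * N) = (3 * of_nat N * fact (3 * N - 1) :: rat)"
    using N by (subst fact_reduce) auto
  have f1: "fact N = (of_nat N * fact (N - 1) :: rat)"
    using N by (subst fact_reduce) auto
  have p4: "(1 / 2 :: rat) ^ (2 * (N + k)) = 1 / 4 ^ (N + k)"
    by (subst power_mult) (simp add: power_divide)
  have N0: "of_nat N \<noteq> (0 :: rat)"
    using N by simp
  show ?thesis
    unfolding h10_def c1 c2 c3 r f3 half_pochhammer p4
    using N0 by (simp add: f1 power2_eq_square power_divide divide_simps del: fact_Suc)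
qed

section \<open>The second WZ pair\<close>

text \<open>At \<open>n = k = 0\<close> the general formula is \<open>0 * (-1)!\<close>, to be read as a limit; truncated subtraction
  would give the wrong value, hence the case distinction.\<close>

definition g11 :: "nat \<Rightarrow> nat \<Rightarrow> rat" where
  "g11 n k = (if n = 0 then if k = 0 then 3 else 0 else
     3 * (-1) ^ k * (11 * of_nat n ^ 2 + (3 - 6 * of_nat k) * of_nat n - of_nat k * (of_nat k + 1))
     * fact (3 * n - k - 1) * pochhammer (1 / 2) n * rfact n k ^ 2
     / (16 ^ n * fact n ^ 2 * pochhammer (1 / 2) k))"

text \<open>Truncation in \<open>3 * n - k - 2\<close> is harmless: it happens only if
  \<open>n = 0\<close> or \<open>k > n\<close>, where the factor \<open>n ^ 2\<close> or
  \<open>rfact n k\<close> vanishes.\<close>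

definition h11 :: "nat \<Rightarrow> nat \<Rightarrow> rat" where
  "h11 n k = -48 * (-1) ^ k * of_nat n ^ 2 * ((of_nat n - of_nat k) * rfact n k) ^ 2
     * fact (3 * n - k - 2) * pochhammer (1 / 2) n
     / (16 ^ n * fact n ^ 2 * pochhammer (1 / 2) (Suc k))"

lemma half_pochhammer_pos: "pochhammer (1 / 2 :: rat) k > 0"
  by (simp add: pochhammer_pos)

lemma wz11: "g11 n (Suc k) - g11 n k = h11 (Suc n) k - h11 n k"
proof (cases "n = 0 \<or> n < k")
  \<comment> \<open>For \<open>n < k\<close> all four terms vanish, \<open>h11 (Suc n) k\<close>
    because \<open>(n + 1 - k) * rfact (Suc n) k = rfact n k\<close>. At \<open>n = k = 0\<close>
    both sides are -3, which forces the value \<open>g11 0 0 = 3\<close>.\<close>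
  case True
  then show ?thesis
    by (cases k) (auto simp: g11_def h11_def rfact_def)
next
  case False
  define x y :: rat where "x = of_nat n" and "y = of_nat k"
  \<comment> \<open>Now \<open>0 < n\<close> and \<open>k \<le> n\<close>, so the subtraction is
    exact and the factorials in the four terms are those of \<open>m\<close>, \<open>m + 1\<close>
    and \<open>m + 3\<close>.\<close>
  define m where "m = 3 * n - k - 2"
  have m: "3 * n = m + k + 2"
    using False unfolding m_def by linarith
  then have "of_nat (3 * n) = (of_nat (m + k + 2) :: rat)"
    by (simp only:)
  then have x3: "of_nat m = 3 * x - y - 2"
    by (simp add: x_def y_def)
  have pos: "x \<ge> 0" "y \<ge> 0"
    by (simp_all add: x_def y_def)
  then have nz: "x + 1 \<noteq> 0" "y + 1 / 2 \<noteq> 0"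
    by linarith+
  \<comment> \<open>Again a common factor that reduces the claim to a polynomial identity.\<close>
  define A where "A = (-1) ^ k * fact m * pochhammer (1 / 2) n * rfact n k ^ 2
     / (16 ^ n * fact n ^ 2 * pochhammer (1 / 2) (Suc k))"
  have ph: "pochhammer (1 / 2) (Suc k) = (y + 1 / 2) * pochhammer (1 / 2 :: rat) k"
    by (simp add: pochhammer_Suc y_def algebra_simps)
  have i: "3 * n - k - 1 = Suc m" "3 * n - Suc k - 1 = m" "3 * Suc n - k - 2 = Suc (Suc (Suc m))"
    using m by auto
  have 1: "g11 n k = A * (3 * (11 * x ^ 2 + (3 - 6 * y) * x - y * (y + 1)) * (3 * x - y - 1) * (y + 1 / 2))"
    using False nz unfolding g11_def A_def ph i
    by (simp add: x3 del: right_diff_distrib_numeral distrib_left_numeral flip: x_def y_def)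
      (simp add: mult_ac del: right_diff_distrib_numeral distrib_left_numeral)
  have Suc_k: "11 * of_nat n ^ 2 + (3 - 6 * of_nat (Suc k)) * of_nat n - of_nat (Suc k) * (of_nat (Suc k) + 1)
      = 11 * x ^ 2 + (- 3 - 6 * y) * x - (y + 1) * (y + 2)"
    by (simp add: x_def y_def algebra_simps)
  have 2: "g11 n (Suc k) = A * (-3 * (11 * x ^ 2 + (- 3 - 6 * y) * x - (y + 1) * (y + 2)) * (x - y) ^ 2)"
    using False unfolding g11_def A_def i rfact_Suc_right Suc_k
    by (simp add: power_mult_distrib mult_ac del: right_diff_distrib_numeral distrib_left_numeral
        flip: x_def y_def)
  have 3: "h11 n k = A * (-48 * x ^ 2 * (x - y) ^ 2)"
    unfolding h11_def A_def m_def[symmetric]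
    by (simp add: power_mult_distrib flip: x_def y_def)
  have f5: "fact (Suc n) = (x + 1) * fact n"
    by (simp add: x_def algebra_simps)
  have f6: "(x + 1 - of_nat k) * rfact (Suc n) k = rfact n k"
    using rfact_Suc_left[of n k] by (simp add: x_def)
  define B where "B = (3 * x - y + 1) * (3 * x - y) * (3 * x - y - 1)"
  have f7: "fact (Suc (Suc (Suc m))) = B * fact m"
    by (simp add: x3 B_def)
  have f8: "of_nat (Suc n) = x + 1" "pochhammer (1 / 2) (Suc n) = (x + 1 / 2) * pochhammer (1 / 2) n"
    by (simp_all add: pochhammer_Suc x_def)
  have 4: "h11 (Suc n) k = A * (-3 * B * (x + 1 / 2))"
    using nz unfolding h11_def A_def i f5 f6 f7 f8 power_Suc
    by (simp add: power_mult_distrib mult_ac del: distrib_left_numeral distrib_right_numeral)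
  show ?thesis
    unfolding 1 2 3 4 B_def by (simp add: algebra_simps power2_eq_square)
qed

lemma g11_0:
  "g11 n 0 = (11 * of_nat n + 3) / 2 ^ (6 * n) * of_nat ((3 * n) choose n) * of_nat ((2 * n) choose n) ^ 2"
proof (cases "n = 0")
  case False
  have p: "(2 :: rat) ^ (6 * n) = 16 ^ n * 4 ^ n"
    by (simp add: power_mult flip: power_mult_distrib)
  have f3: "fact (3 * n) = (3 * of_nat n * fact (3 * n - 1) :: rat)"
    using False by (subst fact_reduce) auto
  show ?thesis
    using False unfolding g11_def half_pochhammer fact_3_choose fact_2_choose rfact_def p f3
    by (simp add: power2_eq_square) (simp add: field_simps)
qed (simp add: g11_def)

section \<open>Integrality of the boundary terms divided by \<open>p\<close>\<close>

text \<open>The factor \<open>p ^ 2\<close> cancels the powers of \<open>p\<close> in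
  \<open>fact p ^ 2\<close>, and \<open>fact (3 * p - k - 2)\<close> supplies one more
  \<open>p\<close>. The denominator \<open>pochhammer (1 / 2) (Suc k)\<close>, which may involve
  \<open>p\<close>, is an initial part of the product \<open>pochhammer (1 / 2) p\<close> and
  cancels.\<close>

lemma p_integral_h11:
  assumes "prime p" "p > 2" "k < p"
  shows "p_integral p (h11 p k / of_nat p)"
proof -
  define j where "j = p - Suc k"
  have p: "p = Suc (k + j)"
    using assms by (simp add: j_def)
  have r: "(of_nat p - of_nat k) * rfact p k = 1 / fact j"
    using rfact_Suc_right[of p k] assms by (simp add: rfact_def j_def)
  have ph: "pochhammer (1 / 2) p
      = pochhammer (1 / 2) (Suc k) * pochhammer (1 / 2 + of_nat (Suc k) :: rat) j"
    using pochhammer_product[of "Suc k" p "1 / 2 :: rat"] assms by (simp add: j_def)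
  have f1: "fact p = (of_nat p * fact (p - 1) :: rat)"
    using p by (subst fact_reduce) auto
  have p0: "of_nat p \<noteq> (0 :: rat)"
    using p by simp
  \<comment> \<open>From \<open>k < p\<close> follows
    \<open>3 * p - k - 2 \<ge> 2 * p - 1 \<ge> p\<close>.\<close>
  have "p dvd fact (3 * p - k - 2)"
    using assms by (simp add: prime_dvd_fact_iff)
  then obtain q where q: "fact (3 * p - k - 2) = p * q"
    by blast
  then have f3: "fact (3 * p - k - 2) = (of_nat p * of_nat q :: rat)"
    by (metis of_nat_fact of_nat_mult)
  have "h11 p k / of_nat p = of_int (-48 * (-1) ^ k * int q) * (1 / 2) ^ (4 * p)
      * (1 / fact j) ^ 2 * (1 / fact (p - 1)) ^ 2 * pochhammer (1 / 2 + of_nat (Suc k)) j"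
    unfolding h11_def r ph f1 f3
    using p0 half_pochhammer_pos[of "Suc k"]
    by (simp add: power_mult power_divide power_mult_distrib power2_eq_square divide_simps
        del: fact_Suc of_nat_Suc)
  also have "p_integral p \<dots>"
    using assms
    by (intro p_integral_mult p_integral_power p_integral_inverse_fact p_integral_half
        p_integral_pochhammer p_integral_add p_integral_of_nat p_integral_of_int)
      (simp_all add: j_def)
  finally show ?thesis .
qed

lemma p_integral_h10:
  assumes "prime p" "p > 2" "k < p"
  shows "p_integral p (h10 p k / of_nat p)"
proof -
  have "h10 p k / of_nat p = of_int (-12 * (-4) ^ k) * (1 / 2) ^ p * (1 / 2) ^ (2 * (p + k))
    * of_nat ((3 * p - 1) choose p) * of_nat ((2 * p - 1) choose (p + k))
    * of_nat ((2 * (p + k)) choose (p - 1))"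
    using assms(3) by (simp add: h10_eq)
  also have "p_integral p \<dots>"
    using assms
    by (intro p_integral_mult p_integral_power p_integral_half p_integral_of_nat p_integral_of_int)
  finally show ?thesis .
qed

section \<open>From a WZ pair to a congruence modulo \<open>p\<close>\<close>

lemma rat_cong_wz_sum:
  assumes "prime p"
    and wz: "\<And>n k. g n (Suc k) - g n k = h (Suc n) k - h n k"
    and h0: "\<And>k. h 0 k = 0"
    and g0: "\<And>n k. n < k \<Longrightarrow> g n k = 0"
    and h: "\<And>k. k < p \<Longrightarrow> p_integral p (h p k / of_nat p)"
  shows "rat_cong p 1 (\<Sum>n = 0..p - 1. g n 0) 0"
proof (rule rat_cong_0I[OF \<open>prime p\<close>])
  have "{0..p - 1} = {..<p}"
    using prime_gt_0_nat[OF \<open>prime p\<close>] by auto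
  then have "(\<Sum>n = 0..p - 1. g n 0) = - (\<Sum>k<p. h p k)"
    using wz_telescope[of g h p] wz h0 g0 by simp
  also have "\<dots> = of_nat p * (of_int (-1) * (\<Sum>k<p. h p k / of_nat p))"
    using prime_gt_0_nat[OF \<open>prime p\<close>] by (simp flip: sum_divide_distrib)
  finally show "(\<Sum>n = 0..p - 1. g n 0) = of_nat p * (of_int (-1) * (\<Sum>k<p. h p k / of_nat p))" .
  show "p_integral p (of_int (-1) * (\<Sum>k<p. h p k / of_nat p))"
    using \<open>prime p\<close> h by (intro p_integral_mult p_integral_of_int p_integral_sum) auto
qed

theorem theorem1:
  fixes p :: nat
  assumes "prime p" and "p > 2"
  shows "rat_cong p 1
           (\<Sum>n = 0..p - 1. (10 * of_nat n + 3) / 2 ^ (3 * n)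
              * of_nat ((3 * n) choose n) * of_nat ((2 * n) choose n) ^ 2) 0 \<and>
         rat_cong p 1
           (\<Sum>n = 0..p - 1. (11 * of_nat n + 3) / 2 ^ (6 * n)
              * of_nat ((3 * n) choose n) * of_nat ((2 * n) choose n) ^ 2) 0"
proof
  have "rat_cong p 1 (\<Sum>n = 0..p - 1. g10 n 0) 0"
    \<comment> \<open>The boundary conditions \<open>h0\<close> and \<open>g0\<close> come from the
      factor \<open>n\<close> of \<open>h10 n k\<close> and the factor \<open>rfact n k\<close> of
      \<open>g10 n k\<close>.\<close>
    by (rule rat_cong_wz_sum[OF \<open>prime p\<close>, where h = h10])
      (simp_all add: wz10 p_integral_h10[OF assms], simp_all add: g10_def h10_def rfact_def)
  then show "rat_cong p 1
           (\<Sum>n = 0..p - 1. (10 * of_nat n + 3) / 2 ^ (3 * n)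
              * of_nat ((3 * n) choose n) * of_nat ((2 * n) choose n) ^ 2) 0"
    unfolding g10_0 .
  have "rat_cong p 1 (\<Sum>n = 0..p - 1. g11 n 0) 0"
    by (rule rat_cong_wz_sum[OF \<open>prime p\<close>, where h = h11])
      (simp_all add: wz11 p_integral_h11[OF assms], simp_all add: g11_def h11_def rfact_def)
  then show "rat_cong p 1
           (\<Sum>n = 0..p - 1. (11 * of_nat n + 3) / 2 ^ (6 * n)
              * of_nat ((3 * n) choose n) * of_nat ((2 * n) choose n) ^ 2) 0"
    unfolding g11_0 .
qed

end
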